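(* Let $f,\phi,\psi,\chi$ be Ramanujan's mock theta functions of order three and let $\omega,\nu,\rho$ be Watson's mock theta functions of order three, as defined in the context. Then for every integer $k\ge 2$ and each choice of sign, at the point $q=\pm 1/k$ each of the seven values $f(q)$, $\phi(q)$, $\psi(q)$, $\chi(q)$, $\omega(q)$, $\nu(q)$, $\rho(q)$ is an irrational number.
   Context: For $q\in\mathbb{C}$ with $|q|<1$, Ramanujan's mock theta functions of order three are $$f(q)=1+\sum_{n=1}^{\infty}\frac{q^{n^2}}{(1+q)^2(1+q^2)^2\cdots(1+q^n)^2},$$ $$\phi(q)=1+\sum_{n=1}^{\infty}\frac{q^{n^2}}{(1+q^2)(1+q^4)\cdots(1+q^{2n})},$$ $$\psi(q)=\sum_{n=1}^{\infty}\frac{q^{n^2}}{(1-q)(1-q^3)\cdots(1-q^{2n-1})},$$ $$\chi(q)=1+\sum_{n=1}^{\infty}\frac{q^{n^2}}{(1-q+q^2)(1-q^2+q^4)\cdots(1-q^n+q^{2n})}.$$ Watson's three additional mock theta functions of order three are $$\omega(q)=\sum_{n=0}^{\infty}\frac{q^{2n(n+1)}}{(1-q)^2(1-q^3)^2\cdots(1-q^{2n+1})^2},$$ $$\nu(q)=\sum_{n=0}^{\infty}\frac{q^{n(n+1)}}{(1+q)(1+q^3)\cdots(1+q^{2n+1})},$$ $$\rho(q)=\sum_{n=0}^{\infty}\frac{q^{2n(n+1)}}{(1+q+q^2)(1+q^3+q^6)\cdots(1+q^{2n+1}+q^{4n+2})}.$$ *)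

theory Defs
  imports "HOL-Analysis.Analysis"
begin

text \<open>
  The third-order mock theta functions, meant for \<open>norm q < 1\<close>. In \<open>mock3_f\<close>, \<open>mock3_phi\<close>,
  \<open>mock3_psi\<close> and \<open>mock3_chi\<close> the classical sum starts at \<open>n = 1\<close>; here the index is shifted,
  so the summand for \<open>n\<close> is the classical one for \<open>Suc n\<close>. The other three sums start
  at \<open>n = 0\<close> as usual. A product over \<open>j \<le> n\<close> includes \<open>j = 0\<close>.
\<close>

definition mock3_f :: "complex \<Rightarrow> complex" where
  "mock3_f q = 1 + (\<Sum>n. q ^ ((Suc n)\<^sup>2) / (\<Prod>j=1..Suc n. (1 + q ^ j)\<^sup>2))"

definition mock3_phi :: "complex \<Rightarrow> complex" where
  "mock3_phi q = 1 + (\<Sum>n. q ^ ((Suc n)\<^sup>2) / (\<Prod>j=1..Suc n. 1 + q ^ (2 * j)))"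

definition mock3_psi :: "complex \<Rightarrow> complex" where
  "mock3_psi q = (\<Sum>n. q ^ ((Suc n)\<^sup>2) / (\<Prod>j\<le>n. 1 - q ^ (2 * j + 1)))"

definition mock3_chi :: "complex \<Rightarrow> complex" where
  "mock3_chi q = 1 + (\<Sum>n. q ^ ((Suc n)\<^sup>2) / (\<Prod>j=1..Suc n. 1 - q ^ j + q ^ (2 * j)))"

definition mock3_omega :: "complex \<Rightarrow> complex" where
  "mock3_omega q = (\<Sum>n. q ^ (2 * n * (n + 1)) / (\<Prod>j\<le>n. (1 - q ^ (2 * j + 1))\<^sup>2))"

definition mock3_nu :: "complex \<Rightarrow> complex" where
  "mock3_nu q = (\<Sum>n. q ^ (n * (n + 1)) / (\<Prod>j\<le>n. 1 + q ^ (2 * j + 1)))"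

definition mock3_rho :: "complex \<Rightarrow> complex" where
  "mock3_rho q =
    (\<Sum>n. q ^ (2 * n * (n + 1)) / (\<Prod>j\<le>n. 1 + q ^ (2 * j + 1) + q ^ (4 * j + 2)))"

end

theory Submission
  imports Defs
begin

text \<open>
  Put \<open>p = 1 / q\<close>, an integer with \<open>\<bar>p\<bar> \<ge> 2\<close>. Clearing the powers of \<open>q\<close> from the products in the
  denominators turns each of the seven series into a Cantor series
  \<open>\<Sum>n. b n / (a 0 * \<dots> * a n)\<close> with nonzero integers \<open>a n\<close> and \<open>b n\<close>; for example
  \<open>q ^ n\<^sup>2 / (\<Prod>j=1..n. (1 + q ^ j)\<^sup>2) = p ^ n / (\<Prod>j=1..n. (p ^ j + 1)\<^sup>2)\<close>. In all cases
  \<open>b n / a n\<close> tends to \<open>0\<close>.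

  Such a series has an irrational sum (lemma \<open>Cantor_series_irrational\<close>): its scaled remainders
  \<open>R N = (a 0 * \<dots> * a (N - 1)) * (\<Sum>n. b (n + N) / (a 0 * \<dots> * a (n + N)))\<close> tend to \<open>0\<close>. If the sum
  were rational with denominator \<open>B\<close>, then all \<open>B * R N\<close> would be integers, so \<open>R N\<close> would vanish
  for all large \<open>N\<close>, which forces the terms of the series to vanish there as well.
  Lemma \<open>reciprocal_product_series_irrational\<close> carries out the rescaling for all seven
  functions at once.
\<close>

section \<open>Irrationality of Cantor series\<close>

lemma Cantor_series_irrational:
  fixes a b :: "nat \<Rightarrow> complex"
  assumes a_Ints: "\<And>n. a n \<in> \<int>" and b_Ints: "\<And>n. b n \<in> \<int>"
    and a_nz: "\<And>n. a n \<noteq> 0" and b_nz: "\<And>n. b n \<noteq> 0"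
    and ratio: "(\<lambda>n. b n / a n) \<longlonglongrightarrow> 0"
  shows "(\<Sum>n. b n / (\<Prod>j\<le>n. a j)) \<in> \<real> - \<rat>"
proof -
  define P where "P n = (\<Prod>j<n. a j)" for n
  define t where "t n = b n / (\<Prod>j\<le>n. a j)" for n
  have P_Suc: "P (Suc n) = P n * a n" for n
    by (simp add: P_def)
  have P_nz: "P n \<noteq> 0" for n
    using a_nz by (simp add: P_def)
  have P_Ints: "P n \<in> \<int>" for n
    unfolding P_def by (intro Ints_prod a_Ints)
  have t_eq: "t n = b n / P (Suc n)" for n
    by (simp add: t_def P_def lessThan_Suc_atMost)
  have t_nz: "t n \<noteq> 0" for n
    using b_nz P_nz by (simp add: t_eq)
  have small: "\<exists>N0. \<forall>n\<ge>N0. norm (b n) \<le> \<delta> * norm (a n)" if "\<delta> > 0" for \<delta> :: real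
  proof -
    from LIMSEQ_D[OF ratio that] obtain N0 where "\<forall>n\<ge>N0. norm (b n / a n) < \<delta>"
      by auto
    then show ?thesis
      using a_nz by (intro exI[of _ N0]) (auto simp: norm_divide field_simps intro: less_imp_le)
  qed
  have b_ge: "norm (b n) \<ge> 1" for n
  proof -
    obtain i where i: "b n = of_int i" using b_Ints Ints_cases by metis
    then have "i \<noteq> 0" using b_nz[of n] by auto
    then show ?thesis by (simp add: i)
  qed
  \<comment> \<open>As \<open>norm (b n) \<ge> 1\<close>, the ratio condition makes \<open>norm (a n)\<close> at least 2 from some point on.\<close>
  obtain N1 where N1: "norm (a n) \<ge> 2" if "n \<ge> N1" for n
  proof -
    obtain N where "\<forall>n\<ge>N. norm (b n) \<le> (1/2) * norm (a n)"
      using small[of "1/2"] by auto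
    then have "norm (a n) \<ge> 2" if "n \<ge> N" for n
      using b_ge[of n] that by fastforce
    then show thesis using that by blast
  qed
  have P_growth: "norm (P N) * 2 ^ m \<le> norm (P (m + N))" if "N \<ge> N1" for N m
  proof (induction m)
    case (Suc m)
    have "norm (P N) * 2 ^ Suc m \<le> norm (P (m + N)) * 2"
      using Suc by simp
    also have "\<dots> \<le> norm (P (m + N)) * norm (a (m + N))"
      using that by (intro mult_left_mono N1) auto
    finally show ?case by (simp add: P_Suc norm_mult)
  qed simp
  have t_bound: "norm (P N * t (m + N)) \<le> \<delta> * (1/2) ^ m"
    if "N \<ge> N1" "norm (b (m + N)) \<le> \<delta> * norm (a (m + N))" "\<delta> > 0" for N m \<delta>
  proof -
    have "norm (P N * t (m + N)) = norm (P N) * norm (b (m + N)) / (norm (P (m + N)) * norm (a (m + N)))"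
      by (simp add: t_eq P_Suc norm_mult norm_divide)
    also have "\<dots> \<le> norm (P N) * (\<delta> * norm (a (m + N))) / (norm (P (m + N)) * norm (a (m + N)))"
      using that by (intro divide_right_mono mult_left_mono) auto
    also have "\<dots> = \<delta> * (norm (P N) / norm (P (m + N)))"
      using a_nz by simp
    also have "\<dots> \<le> \<delta> * (1/2) ^ m"
      using P_growth[OF that(1), of m] P_nz[of "m + N"] that(3)
      by (intro mult_left_mono) (auto simp: field_simps)
    finally show ?thesis .
  qed
  have geo: "(\<lambda>m. \<delta> * (1/2) ^ m) sums (2 * \<delta>)" for \<delta> :: real
    using sums_mult[OF geometric_sums[of "1/2::real"], of \<delta>] by (simp add: mult.commute)
  have summ: "summable t"
  proof -
    obtain N0 where N0: "\<forall>n\<ge>N0. norm (b n) \<le> 1 * norm (a n)"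
      using small[of 1] by auto
    define N where "N = max N0 N1"
    have "summable (\<lambda>m. P N * t (m + N))"
    proof (rule summable_comparison_test')
      show "summable (\<lambda>m. 1 * (1/2) ^ m :: real)"
        using geo[of 1] sums_summable by blast
      show "norm (P N * t (m + N)) \<le> 1 * (1/2) ^ m" if "m \<ge> 0" for m
        using N0 by (intro t_bound) (auto simp: N_def)
    qed
    then have "summable (\<lambda>m. t (m + N))"
      using P_nz[of N] by (simp add: summable_cmult_iff)
    then show ?thesis by (simp add: summable_iff_shift)
  qed
  define x where "x = suminf t"
  define R where "R N = P N * (\<Sum>m. t (m + N))" for N
  have R_small: "norm (R N) \<le> 2 * \<delta>"
    if N: "N \<ge> N1" "\<forall>n\<ge>N. norm (b n) \<le> \<delta> * norm (a n)" and "\<delta> > 0" for N \<delta>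
  proof -
    have "norm (\<Sum>m. P N * t (m + N)) \<le> (\<Sum>m. \<delta> * (1/2) ^ m)"
      using that geo[of \<delta>] by (intro norm_suminf_le t_bound) (auto simp: sums_iff)
    also have "(\<Sum>m. \<delta> * (1/2) ^ m) = 2 * \<delta>"
      by (rule sums_unique[OF geo, symmetric])
    also have "(\<Sum>m. P N * t (m + N)) = R N"
      using summ by (simp add: R_def suminf_mult summable_iff_shift)
    finally show ?thesis .
  qed
  have x_split: "P N * x = P N * (\<Sum>n<N. t n) + R N" for N
    using suminf_split_initial_segment[OF summ, of N] by (simp add: x_def R_def algebra_simps)
  have partial_Ints: "P N * (\<Sum>n<N. t n) \<in> \<int>" for N
  proof (induction N)
    case (Suc N)
    have "P (Suc N) * (\<Sum>n<Suc N. t n) = a N * (P N * (\<Sum>n<N. t n)) + b N"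
      using P_nz[of "Suc N"] by (simp add: t_eq P_Suc[of N] algebra_simps)
    then show ?case using Suc a_Ints b_Ints by (metis Ints_add Ints_mult)
  qed simp
  have "x \<notin> \<rat>"
  proof
    assume "x \<in> \<rat>"
    then obtain A B :: int where B: "B > 0" "x = of_int A / of_int B"
      by (elim Rats_cases')
    define \<delta> where "\<delta> = 1 / (4 * real_of_int B)"
    have \<delta>: "\<delta> > 0" using B by (simp add: \<delta>_def)
    obtain N0 where N0: "\<forall>n\<ge>N0. norm (b n) \<le> \<delta> * norm (a n)"
      using small[OF \<delta>] by blast
    define N where "N = max N0 N1"
    have R_zero: "R M = 0" if "M \<ge> N" for M
    proof -
      have "of_int B * R M = P M * of_int A - of_int B * (P M * (\<Sum>n<M. t n))"
      proof -
        have "of_int B * R M = P M * (of_int B * x) - of_int B * (P M * (\<Sum>n<M. t n))"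
          using x_split[of M] by algebra
        then show ?thesis using B by simp
      qed
      also have "\<dots> \<in> \<int>"
        by (intro Ints_diff Ints_mult[OF P_Ints] Ints_mult[OF _ partial_Ints] Ints_of_int)
      finally obtain i where i: "of_int B * R M = of_int i"
        by (elim Ints_cases)
      have "norm (R M) \<le> 2 * \<delta>"
        using that N0 \<delta> by (intro R_small) (auto simp: N_def)
      then have "norm (of_int B * R M) \<le> of_int B * (2 * \<delta>)"
        using B by (simp add: norm_mult)
      also have "\<dots> < 1"
        using B by (simp add: \<delta>_def)
      finally have "i = 0" by (simp add: i)
      then show ?thesis using i B by simp
    qed
    have "(\<Sum>m. t (m + N)) = 0" "(\<Sum>m. t (m + Suc N)) = 0"
      using R_zero[of N] R_zero[of "Suc N"] P_nz by (simp_all add: R_def)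
    moreover have "(\<Sum>m. t (m + N)) = t N + (\<Sum>m. t (m + Suc N))"
      using suminf_split_head[of "\<lambda>m. t (m + N)"] summ by (simp add: summable_iff_shift)
    ultimately show False using t_nz[of N] by simp
  qed
  moreover have "x \<in> \<real>"
  proof -
    have "z \<in> \<real>" if "z \<in> \<int>" for z :: complex
      using that by (auto elim: Ints_cases)
    then have "t n \<in> \<real>" for n
      using b_Ints P_Ints unfolding t_eq by (metis Reals_divide)
    then have "(\<lambda>n. Im (t n)) = (\<lambda>n. 0)"
      by (simp add: complex_is_Real_iff)
    moreover have "(\<lambda>n. Im (t n)) sums Im x"
      using summ unfolding x_def by (intro sums_Im summable_sums)
    ultimately have "Im x = 0"
      using sums_unique2 sums_zero by metis
    then show ?thesis by (simp add: complex_is_Real_iff)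
  qed
  ultimately show ?thesis by (simp add: x_def t_def[abs_def])
qed

section \<open>Series of reciprocals of products at reciprocals of integers\<close>

text \<open>
  In the applications \<open>F\<close> is a polynomial of degree \<open>h\<close> with integer coefficients and constant
  term \<open>1\<close>, and \<open>rev\<close> says that reversing its coefficients gives a polynomial with integer values
  at integers. With \<open>p = 1 / q\<close>, the condition \<open>e\<close> makes the terms of the series equal to
  \<open>p ^ c n / (\<Prod>j\<le>n. p ^ (h * m j) * F (q ^ m j))\<close>, and the condition \<open>c\<close> makes the quotient of
  \<open>p ^ c n\<close> by the last factor \<open>p ^ (h * m n) * F (q ^ m n)\<close> tend to \<open>0\<close>.
\<close>

lemma reciprocal_product_series_irrational:
  fixes k :: int and q :: complex and F :: "complex \<Rightarrow> complex"
    and c e m :: "nat \<Rightarrow> nat" and h :: nat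
  assumes k: "k \<ge> 2" and q: "q = 1 / of_int k \<or> q = - (1 / of_int k)"
    and cont: "isCont F 0" and F0: "F 0 = 1"
    and nz: "\<And>x. norm x < 1 \<Longrightarrow> F x \<noteq> 0"
    and rev: "\<And>P. P \<in> \<int> \<Longrightarrow> P \<noteq> 0 \<Longrightarrow> P ^ h * F (1 / P) \<in> \<int>"
    and m: "\<And>n. n < m n"
    and c: "\<And>n. c n + n \<le> h * m n"
    and e: "\<And>n. e n + c n = (\<Sum>j\<le>n. h * m j)"
  shows "(\<Sum>n. q ^ e n / (\<Prod>j\<le>n. F (q ^ m j))) \<in> \<real> - \<rat>"
proof -
  define p where "p = 1 / q"
  have p_Ints: "p \<in> \<int>" and q_nz: "q \<noteq> 0" and q_lt: "norm q < 1"
    using k q by (auto simp: p_def norm_divide)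
  have p_nz: "p \<noteq> 0" and qp: "q = 1 / p" using q_nz by (auto simp: p_def)
  have q_pow: "norm (q ^ n) < 1" if "n > 0" for n
    using q_lt that by (simp add: norm_power power_less_one_iff)
  define a where "a n = p ^ (h * m n) * F (q ^ m n)" for n
  have a_nz: "a n \<noteq> 0" for n
    using p_nz nz[OF q_pow] m[of n] by (simp add: a_def)
  have a_Ints: "a n \<in> \<int>" for n
    using rev[of "p ^ m n"] p_Ints p_nz
    by (simp add: a_def qp power_mult power_one_over mult.commute[of h])
  have term_eq: "q ^ e n / (\<Prod>j\<le>n. F (q ^ m j)) = p ^ c n / (\<Prod>j\<le>n. a j)" for n
  proof -
    have "(\<Prod>j\<le>n. a j) = p ^ (e n + c n) * (\<Prod>j\<le>n. F (q ^ m j))"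
      by (simp add: a_def prod.distrib e power_sum)
    then show ?thesis using p_nz by (simp add: qp power_add power_one_over)
  qed
  have ratio: "(\<lambda>n. p ^ c n / a n) \<longlonglongrightarrow> 0"
  proof -
    have q_tendsto: "(\<lambda>n. q ^ r n) \<longlonglongrightarrow> 0" if "\<And>n. n \<le> r n" for r
    proof (rule Lim_null_comparison)
      show "\<forall>\<^sub>F n in sequentially. norm (q ^ r n) \<le> norm q ^ n"
        using q_lt that by (auto simp: norm_power intro!: always_eventually power_decreasing)
      show "(\<lambda>n. norm q ^ n) \<longlonglongrightarrow> 0"
        using q_lt by (intro LIMSEQ_power_zero) auto
    qed
    have "(\<lambda>n. F (q ^ m n)) \<longlonglongrightarrow> F 0"
      using q_tendsto[of m] m by (intro isCont_tendsto_compose[OF cont]) (auto intro: less_imp_le)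
    moreover have "(\<lambda>n. q ^ (h * m n - c n)) \<longlonglongrightarrow> 0"
      using c by (intro q_tendsto) (metis add_le_imp_le_diff add.commute)
    ultimately have "(\<lambda>n. q ^ (h * m n - c n) / F (q ^ m n)) \<longlonglongrightarrow> 0 / F 0"
      using F0 by (intro tendsto_divide) auto
    moreover have "q ^ (h * m n - c n) / F (q ^ m n) = p ^ c n / a n" for n
    proof -
      have "p ^ (h * m n) = p ^ c n * p ^ (h * m n - c n)"
        using c[of n] by (simp flip: power_add)
      then show ?thesis using p_nz by (simp add: a_def qp power_one_over)
    qed
    ultimately show ?thesis by simp
  qed
  show ?thesis
    unfolding term_eq using a_Ints a_nz p_Ints p_nz ratio
    by (intro Cantor_series_irrational) auto
qed

section \<open>The third-order mock theta functions\<close>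

lemma one_add_in_Reals_minus_Rats:
  fixes x :: complex
  assumes "x \<in> \<real> - \<rat>"
  shows "1 + x \<in> \<real> - \<rat>"
  using assms Rats_diff[of "1 + x" 1] by auto

lemma one_add_nonzero:
  fixes x :: complex
  assumes "norm x < 1"
  shows "1 + x \<noteq> 0"
proof
  assume "1 + x = 0"
  then have "x = - 1" by (simp add: add_eq_0_iff)
  then show False using assms by simp
qed

lemma quadratic_nonzero:
  fixes x :: complex
  assumes "norm x < 1"
  shows "1 - x + x\<^sup>2 \<noteq> 0"
proof
  assume "1 - x + x\<^sup>2 = 0"
  \<comment> \<open>\<open>(1 + x) * (1 - x + x\<^sup>2) = 1 + x ^ 3\<close>\<close>
  then have "1 + x ^ 3 = 0"
    by algebra
  moreover have "norm (x ^ 3) < 1"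
    using assms by (simp add: norm_power power_less_one_iff)
  ultimately show False using one_add_nonzero by blast
qed

theorem theorem2p1:
  fixes k :: int and q :: complex
  assumes "k \<ge> 2"
    and "q = 1 / of_int k \<or> q = - (1 / of_int k)"
  shows "mock3_f q \<in> \<real> - \<rat> \<and> mock3_phi q \<in> \<real> - \<rat> \<and> mock3_psi q \<in> \<real> - \<rat> \<and>
         mock3_chi q \<in> \<real> - \<rat> \<and> mock3_omega q \<in> \<real> - \<rat> \<and> mock3_nu q \<in> \<real> - \<rat> \<and>
         mock3_rho q \<in> \<real> - \<rat>"
proof -
  note series = reciprocal_product_series_irrational[OF assms]
  have shift: "(\<Prod>j=1..Suc n. g j) = (\<Prod>j\<le>n. g (Suc j))" for g :: "nat \<Rightarrow> complex" and n
    by (simp add: prod.atLeast_Suc_atMost_Suc_shift atMost_atLeast0 del: prod.cl_ivl_Suc)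
  have rev_plus: "P ^ 1 * (1 + 1 / P) \<in> \<int>" and rev_minus: "P ^ 1 * (1 - 1 / P) \<in> \<int>"
    and rev_plus_sq: "P ^ 2 * (1 + 1 / P)\<^sup>2 \<in> \<int>" and rev_minus_sq: "P ^ 2 * (1 - 1 / P)\<^sup>2 \<in> \<int>"
    and rev_quad_minus: "P ^ 2 * (1 - 1 / P + (1 / P)\<^sup>2) \<in> \<int>"
    and rev_quad_plus: "P ^ 2 * (1 + 1 / P + (1 / P)\<^sup>2) \<in> \<int>"
    if "P \<in> \<int>" "P \<noteq> 0" for P :: complex
  proof -
    have "P ^ 1 * (1 + 1 / P) = P + 1" "P ^ 1 * (1 - 1 / P) = P - 1"
      "P ^ 2 * (1 + 1 / P)\<^sup>2 = (P + 1)\<^sup>2" "P ^ 2 * (1 - 1 / P)\<^sup>2 = (P - 1)\<^sup>2"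
      "P ^ 2 * (1 - 1 / P + (1 / P)\<^sup>2) = P\<^sup>2 - P + 1"
      "P ^ 2 * (1 + 1 / P + (1 / P)\<^sup>2) = P\<^sup>2 + P + 1"
      using that(2) by (simp_all add: field_simps power2_eq_square)
    then show "P ^ 1 * (1 + 1 / P) \<in> \<int>" "P ^ 1 * (1 - 1 / P) \<in> \<int>"
      "P ^ 2 * (1 + 1 / P)\<^sup>2 \<in> \<int>" "P ^ 2 * (1 - 1 / P)\<^sup>2 \<in> \<int>"
      "P ^ 2 * (1 - 1 / P + (1 / P)\<^sup>2) \<in> \<int>" "P ^ 2 * (1 + 1 / P + (1 / P)\<^sup>2) \<in> \<int>"
      using that(1) by simp_all
  qed
  have nz_minus: "1 - x \<noteq> 0" and nz_quad: "1 + x + x\<^sup>2 \<noteq> 0" if "norm x < 1" for x :: complex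
    using one_add_nonzero[of "- x"] quadratic_nonzero[of "- x"] that by auto
  have sum_even: "(\<Sum>j\<le>n. 2 * Suc j) = (Suc n)\<^sup>2 + Suc n" for n
    by (induction n) (auto simp: power2_eq_square)
  have sum_odd: "(\<Sum>j\<le>n. 2 * j + 1) = (Suc n)\<^sup>2" for n
    by (induction n) (auto simp: power2_eq_square)
  have sum_odd2: "(\<Sum>j\<le>n. 2 * (2 * j + 1)) = 2 * (Suc n)\<^sup>2" for n
    by (induction n) (auto simp: power2_eq_square)

  \<comment> \<open>The arguments of \<open>series\<close> are \<open>F\<close>, \<open>h\<close>, \<open>m\<close>, \<open>c\<close>, \<open>e\<close>, where \<open>c n\<close> is \<open>(\<Sum>j\<le>n. h * m j) - e n\<close>.\<close>
  have "(\<Sum>n. q ^ (Suc n)\<^sup>2 / (\<Prod>j\<le>n. (1 + q ^ Suc j)\<^sup>2)) \<in> \<real> - \<rat>"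
    using series[of "\<lambda>x. (1 + x)\<^sup>2" 2 "\<lambda>n. Suc n" "\<lambda>n. Suc n" "\<lambda>n. (Suc n)\<^sup>2"]
      one_add_nonzero rev_plus_sq sum_even by simp
  then have f: "mock3_f q \<in> \<real> - \<rat>"
    unfolding mock3_f_def shift by (rule one_add_in_Reals_minus_Rats)

  have "(\<Sum>n. q ^ (Suc n)\<^sup>2 / (\<Prod>j\<le>n. 1 + q ^ (2 * Suc j))) \<in> \<real> - \<rat>"
    using series[of "\<lambda>x. 1 + x" 1 "\<lambda>n. 2 * Suc n" "\<lambda>n. Suc n" "\<lambda>n. (Suc n)\<^sup>2"]
      one_add_nonzero rev_plus sum_even by simp
  then have phi: "mock3_phi q \<in> \<real> - \<rat>"
    unfolding mock3_phi_def shift by (rule one_add_in_Reals_minus_Rats)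

  have psi: "mock3_psi q \<in> \<real> - \<rat>"
    unfolding mock3_psi_def
    using series[of "\<lambda>x. 1 - x" 1 "\<lambda>n. 2 * n + 1" "\<lambda>n. 0" "\<lambda>n. (Suc n)\<^sup>2"]
      nz_minus rev_minus sum_odd by simp

  have "(\<Sum>n. q ^ (Suc n)\<^sup>2 / (\<Prod>j\<le>n. 1 - q ^ Suc j + q ^ (2 * Suc j))) \<in> \<real> - \<rat>"
    unfolding power_even_eq
    using series[of "\<lambda>x. 1 - x + x\<^sup>2" 2 "\<lambda>n. Suc n" "\<lambda>n. Suc n" "\<lambda>n. (Suc n)\<^sup>2"]
      quadratic_nonzero rev_quad_minus sum_even by simp
  then have chi: "mock3_chi q \<in> \<real> - \<rat>"
    unfolding mock3_chi_def shift by (rule one_add_in_Reals_minus_Rats)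

  have omega: "mock3_omega q \<in> \<real> - \<rat>"
    unfolding mock3_omega_def
    using series[of "\<lambda>x. (1 - x)\<^sup>2" 2 "\<lambda>n. 2 * n + 1" "\<lambda>n. 2 * Suc n" "\<lambda>n. 2 * n * (n + 1)"]
      nz_minus rev_minus_sq sum_odd2 by (simp add: power2_eq_square)

  have nu: "mock3_nu q \<in> \<real> - \<rat>"
    unfolding mock3_nu_def
    using series[of "\<lambda>x. 1 + x" 1 "\<lambda>n. 2 * n + 1" "\<lambda>n. Suc n" "\<lambda>n. n * (n + 1)"]
      one_add_nonzero rev_plus sum_odd by (simp add: power2_eq_square)

  have square: "q ^ (4 * j + 2) = (q ^ (2 * j + 1))\<^sup>2" for j
    by (simp flip: power_mult add: algebra_simps del: power_Suc)
  have rho: "mock3_rho q \<in> \<real> - \<rat>"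
    unfolding mock3_rho_def square
    using series[of "\<lambda>x. 1 + x + x\<^sup>2" 2 "\<lambda>n. 2 * n + 1" "\<lambda>n. 2 * Suc n" "\<lambda>n. 2 * n * (n + 1)"]
      nz_quad rev_quad_plus sum_odd2 by (simp add: power2_eq_square)

  show ?thesis using f phi psi chi omega nu rho by blast
qed

end
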